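(* If a finite poset $X$ is a finite closed homology manifold, then $X$ is homologically admissible.
   Context: All posets are finite and homology is reduced with integer coefficients. The order complex $\mathcal{K}(X)$ of a poset $X$ is the simplicial complex of non-empty chains of $X$, and the homology of a poset means the homology of its order complex. A poset $X$ is a finite closed homology manifold (of dimension $n$) if $\mathcal{K}(X)$ is a closed homology $n$-manifold, i.e. $\mathcal{K}(X)$ has dimension $n$ and the link of every $k$-simplex $\sigma\in\mathcal{K}(X)$ has the homology of $S^{n-k-1}$ (with $S^{-1}=\emptyset$). For $x\in X$, $\hat U_x=\{y\in X: y<x\}$. Write $w\prec x$ if $w<x$ and there is no $z$ with $w<z<x$; the edges of the Hasse diagram $\mathcal{H}(X)$ are the pairs $(w,x)$ with $w\prec x$. An edge $(w,x)$ is homologically admissible if $\hat U_x\setminus\{w\}$ is acyclic, i.e. all its reduced integral homology groups vanish. A poset is homologically admissible if all edges of its Hasse diagram are homologically admissible. *)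

theory Defs
  imports "HOL-Homology.Homology"
begin

text \<open>A finite poset is a finite subset \<open>X\<close> of a type of class \<open>order\<close>, with the induced order.\<close>

definition order_complex :: "'a::order set \<Rightarrow> 'a set set"
  where "order_complex X = {\<sigma>. \<sigma> \<noteq> {} \<and> \<sigma> \<subseteq> X \<and> Complete_Partial_Order.chain (\<le>) \<sigma>}"

definition strict_below :: "'a::order set \<Rightarrow> 'a \<Rightarrow> 'a set"
  where "strict_below X x = {y \<in> X. y < x}"

definition hasse_edges :: "'a::order set \<Rightarrow> ('a \<times> 'a) set"
  where "hasse_edges X = {(w, x). w \<in> X \<and> x \<in> X \<and> w < x \<and> \<not> (\<exists>z\<in>X. w < z \<and> z < x)}"

text \<open>
  A simplicial complex is given by its set of non-empty finite simplices. Wherever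
  homology is taken, each simplex is a chain of the vertex order; this holds for order complexes and for links in them,
  and the order orients every simplex. The empty simplex is the only one of dimension \<open>-1\<close>;
  it belongs to the augmented chain complex.
\<close>

definition simplices :: "int \<Rightarrow> 'a set set \<Rightarrow> 'a set set"
  where "simplices k K = {\<sigma> \<in> K. int (card \<sigma>) = k + 1}"

definition simplicial_chain_group :: "int \<Rightarrow> 'a set set \<Rightarrow> ('a set \<Rightarrow>\<^sub>0 int) monoid"
  where "simplicial_chain_group p K = free_Abelian_group (simplices p (insert {} K))"

text \<open>
  On a simplex \<open>v\<^sub>0 < \<dots> < v\<^sub>p\<close> this is \<open>\<Sum>i. (-1)^i [v\<^sub>0,\<dots>,v\<^sub>p without v\<^sub>i]\<close>: the exponent counts the
  vertices below the omitted one. On vertices it is the augmentation \<open>[v] \<mapsto> [{}]\<close>.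
\<close>

definition simplicial_boundary :: "('a::order set \<Rightarrow>\<^sub>0 int) \<Rightarrow> ('a set \<Rightarrow>\<^sub>0 int)"
  where "simplicial_boundary =
    frag_extend (\<lambda>\<sigma>. \<Sum>v\<in>\<sigma>. frag_cmul ((-1) ^ card {u \<in> \<sigma>. u < v}) (frag_of (\<sigma> - {v})))"

definition simplicial_cycles :: "int \<Rightarrow> 'a::order set set \<Rightarrow> ('a set \<Rightarrow>\<^sub>0 int) set"
  where "simplicial_cycles p K =
    kernel (simplicial_chain_group p K) (simplicial_chain_group (p - 1) K) simplicial_boundary"

definition simplicial_boundaries :: "int \<Rightarrow> 'a::order set set \<Rightarrow> ('a set \<Rightarrow>\<^sub>0 int) set"
  where "simplicial_boundaries p K =
    simplicial_boundary ` carrier (simplicial_chain_group (p + 1) K)"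

definition reduced_simplicial_homology_group ::
    "int \<Rightarrow> 'a::order set set \<Rightarrow> ('a set \<Rightarrow>\<^sub>0 int) set monoid"
  where "reduced_simplicial_homology_group p K =
    subgroup_generated (simplicial_chain_group p K) (simplicial_cycles p K)
      Mod simplicial_boundaries p K"

definition acyclic_poset :: "'a::order set \<Rightarrow> bool"
  where "acyclic_poset X \<longleftrightarrow>
    (\<forall>p. trivial_group (reduced_simplicial_homology_group p (order_complex X)))"

text \<open>
  \<open>S\<^sup>-\<^sup>1\<close> is the empty space, whose reduced homology is \<open>\<int>\<close> in degree \<open>-1\<close> and zero otherwise. The
  library's \<open>reduced_homology_group\<close> vanishes in negative degrees, also for the empty space, so
  this case is separate.
\<close>

definition has_homology_of_sphere :: "int \<Rightarrow> 'a::order set set \<Rightarrow> bool"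
  where "has_homology_of_sphere d K \<longleftrightarrow>
    (if d = -1
     then reduced_simplicial_homology_group (-1) K \<cong> integer_group \<and>
          (\<forall>p. p \<noteq> -1 \<longrightarrow> trivial_group (reduced_simplicial_homology_group p K))
     else d \<ge> 0 \<and>
          (\<forall>p. reduced_simplicial_homology_group p K \<cong> reduced_homology_group p (nsphere (nat d))))"

definition link :: "'a set set \<Rightarrow> 'a set \<Rightarrow> 'a set set"
  where "link K \<sigma> = {\<tau> \<in> K. \<tau> \<inter> \<sigma> = {} \<and> \<tau> \<union> \<sigma> \<in> K}"

text \<open>For finite complexes; the empty complex has dimension \<open>-1\<close>.\<close>

definition complex_dim :: "'a set set \<Rightarrow> int"
  where "complex_dim K = Max (insert (-1) ((\<lambda>\<sigma>. int (card \<sigma>) - 1) ` K))"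

definition closed_homology_manifold :: "int \<Rightarrow> 'a::order set set \<Rightarrow> bool"
  where "closed_homology_manifold n K \<longleftrightarrow>
    complex_dim K = n \<and>
    (\<forall>k. \<forall>\<sigma>\<in>simplices k K. has_homology_of_sphere (n - k - 1) (link K \<sigma>))"

definition finite_closed_homology_manifold :: "'a::order set \<Rightarrow> bool"
  where "finite_closed_homology_manifold X \<longleftrightarrow>
    finite X \<and> (\<exists>n. closed_homology_manifold n (order_complex X))"

definition homologically_admissible_edge :: "'a::order set \<Rightarrow> 'a \<times> 'a \<Rightarrow> bool"
  where "homologically_admissible_edge X = (\<lambda>(w, x). acyclic_poset (strict_below X x - {w}))"

definition homologically_admissible :: "'a::order set \<Rightarrow> bool"
  where "homologically_admissible X \<longleftrightarrow> (\<forall>e\<in>hasse_edges X. homologically_admissible_edge X e)"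

end

theory Submission
  imports Defs
begin

text \<open>
  For \<open>x \<in> X\<close>, the set of elements below \<open>x\<close> has as order complex \<open>M\<close> the link of a maximal chain
  starting at \<open>x\<close>; hence \<open>M\<close> and all links in it have the homology of spheres of the right dimension.
  If \<open>M\<close> has dimension \<open>d\<close>, then a \<open>d\<close>-cycle of such a complex has the same absolute
  coefficient on all facets, and a fundamental cycle \<open>\<mu>\<close> has coefficients \<open>\<plusminus>1\<close>. Let \<open>w\<close> be a vertex of \<open>M\<close> and
  \<open>z\<close> a cycle of \<open>M\<close> avoiding \<open>w\<close>. If \<open>z\<close> has dimension \<open>d\<close>, it vanishes. Otherwise \<open>z = \<partial>b\<close> in \<open>M\<close>,
  and the part of \<open>b\<close> at \<open>w\<close> is a cycle of the link of \<open>w\<close>: it is a boundary or, in top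
  dimension, a multiple of the part of \<open>\<mu>\<close> at \<open>w\<close>. Either way a cycle of \<open>M\<close> can be subtracted from \<open>b\<close>
  such that the result avoids \<open>w\<close>.
\<close>

subsection \<open>Simplicial chains and their parts at a vertex\<close>

text \<open>The sign with which the face omitting \<open>v\<close> occurs in the boundary of a
  simplex that contains \<open>v\<close>.\<close>

definition vertex_sign :: "'a::order \<Rightarrow> 'a set \<Rightarrow> int"
  where "vertex_sign v \<sigma> = (-1) ^ card {u \<in> \<sigma>. u < v}"

text \<open>The part of the boundary obtained by omitting \<open>v\<close>. Splitting the boundary
  by the omitted vertex reduces its sign computations to pairs of vertices, and the part at
  \<open>v\<close> is a chain of the link of \<open>v\<close>.\<close>

definition link_part :: "'a::order \<Rightarrow> ('a set \<Rightarrow>\<^sub>0 int) \<Rightarrow> ('a set \<Rightarrow>\<^sub>0 int)"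
  where "link_part v = frag_extend
    (\<lambda>\<sigma>. if v \<in> \<sigma> then frag_cmul (vertex_sign v \<sigma>) (frag_of (\<sigma> - {v})) else 0)"

lemma link_part_0 [simp]: "link_part v 0 = 0"
  and link_part_diff: "link_part v (a - b) = link_part v a - link_part v b"
  and link_part_cmul: "link_part v (frag_cmul n a) = frag_cmul n (link_part v a)"
  and link_part_minus: "link_part v (- a) = - link_part v a"
  by (simp_all add: link_part_def frag_extend_diff frag_extend_cmul frag_extend_minus)

lemma link_part_sum: "finite I \<Longrightarrow> link_part v (\<Sum>i\<in>I. f i) = (\<Sum>i\<in>I. link_part v (f i))"
  by (simp add: link_part_def frag_extend_sum)

lemma boundary_0 [simp]: "simplicial_boundary 0 = 0"
  and boundary_add: "simplicial_boundary (a + b) = simplicial_boundary a + simplicial_boundary b"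
  and boundary_diff: "simplicial_boundary (a - b) = simplicial_boundary a - simplicial_boundary b"
  and boundary_cmul: "simplicial_boundary (frag_cmul n a) = frag_cmul n (simplicial_boundary a)"
  and boundary_minus: "simplicial_boundary (- a) = - simplicial_boundary a"
  by (simp_all add: simplicial_boundary_def frag_extend_add frag_extend_diff frag_extend_cmul frag_extend_minus)

lemma vertex_sign_insert_self [simp]: "vertex_sign v (insert v \<sigma>) = vertex_sign v \<sigma>"
  and vertex_sign_remove_self [simp]: "vertex_sign v (\<sigma> - {v}) = vertex_sign v \<sigma>"
  unfolding vertex_sign_def by (rule arg_cong[where f = "\<lambda>A. (-1) ^ card A"]; auto)+

lemma abs_vertex_sign [simp]: "\<bar>vertex_sign v \<sigma>\<bar> = 1"
  and vertex_sign_square [simp]: "vertex_sign v \<sigma> * vertex_sign v \<sigma> = 1"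
  by (simp_all add: vertex_sign_def power_abs flip: power_mult_distrib)

text \<open>Only \<open>insert v \<tau>\<close> has \<open>\<tau>\<close> as its face omitting
  \<open>v\<close>. Since \<open>v\<close> is not below itself, the sign can be read off from
  \<open>\<tau>\<close>.\<close>

lemma lookup_link_part:
  "Poly_Mapping.lookup (link_part v c) \<tau> =
    (if v \<in> \<tau> then 0 else vertex_sign v \<tau> * Poly_Mapping.lookup c (insert v \<tau>))"
  using subset_UNIV[of "Poly_Mapping.keys c"]
proof (induction c rule: frag_induction)
  case (one \<sigma>)
  show ?case
    by (auto simp: link_part_def)
qed (auto simp: link_part_diff lookup_minus algebra_simps)

lemma boundary_eq_sum_link_part:
  assumes "finite V" "\<And>\<sigma>. \<sigma> \<in> Poly_Mapping.keys c \<Longrightarrow> \<sigma> \<subseteq> V"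
  shows "simplicial_boundary c = (\<Sum>v\<in>V. link_part v c)"
proof -
  have "Poly_Mapping.keys c \<subseteq> Pow V"
    using assms(2) by auto
  then show ?thesis
  proof (induction c rule: frag_induction)
    case (one \<sigma>)
    then have "V \<inter> {v. v \<in> \<sigma>} = \<sigma>" by auto
    then show ?case
      using \<open>finite V\<close> by (simp add: simplicial_boundary_def link_part_def vertex_sign_def sum.If_cases)
  qed (simp_all add: boundary_diff link_part_diff sum_subtractf)
qed

lemma sum_antisymmetric:
  fixes f :: "'b \<Rightarrow> 'b \<Rightarrow> int"
  assumes "\<And>x y. x \<in> V \<Longrightarrow> y \<in> V \<Longrightarrow> f x y = - f y x"
  shows "(\<Sum>x\<in>V. \<Sum>y\<in>V. f x y) = 0"
proof -
  have "(\<Sum>x\<in>V. \<Sum>y\<in>V. f x y) = (\<Sum>x\<in>V. \<Sum>y\<in>V. - f y x)"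
    by (intro sum.cong refl assms)
  also have "\<dots> = - (\<Sum>y\<in>V. \<Sum>x\<in>V. f y x)"
    by (subst sum.swap) (simp add: sum_negf)
  finally show ?thesis by simp
qed

text \<open>
  Chains are indexed by the number \<open>k\<close> of vertices of a simplex, so \<open>k\<close> corresponds to dimension
  \<open>k - 1\<close>; the complexes here contain the empty simplex.
\<close>

definition simplicial_chains :: "nat \<Rightarrow> 'a set set \<Rightarrow> ('a set \<Rightarrow>\<^sub>0 int) set"
  where "simplicial_chains k K = {c. Poly_Mapping.keys c \<subseteq> {\<sigma> \<in> K. card \<sigma> = k}}"

text \<open>The empty simplex makes the chain complex augmented. Each simplex being totally ordered
  is what makes the signs alternate correctly. Order complexes with \<open>{}\<close> added have
  this form, and so do links in them.\<close>

definition ordered_complex :: "'a::order set set \<Rightarrow> bool"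
  where "ordered_complex K \<longleftrightarrow> finite (\<Union>K) \<and> {} \<in> K \<and>
    (\<forall>\<sigma>\<in>K. (\<forall>\<tau>. \<tau> \<subseteq> \<sigma> \<longrightarrow> \<tau> \<in> K) \<and> Complete_Partial_Order.chain (\<le>) \<sigma>)"

lemma ordered_complex_finite: "ordered_complex K \<Longrightarrow> \<sigma> \<in> K \<Longrightarrow> finite \<sigma>"
  unfolding ordered_complex_def by (meson Union_upper finite_subset)

lemma ordered_complex_subset: "ordered_complex K \<Longrightarrow> \<sigma> \<in> K \<Longrightarrow> \<tau> \<subseteq> \<sigma> \<Longrightarrow> \<tau> \<in> K"
  unfolding ordered_complex_def by blast

lemma ordered_complex_comparable:
  "ordered_complex K \<Longrightarrow> \<sigma> \<in> K \<Longrightarrow> u \<in> \<sigma> \<Longrightarrow> v \<in> \<sigma> \<Longrightarrow> u \<le> v \<or> v \<le> u"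
  unfolding ordered_complex_def by (blast dest: Complete_Partial_Order.chainD)

lemma vertex_sign_insert:
  assumes "finite \<sigma>" "u \<notin> \<sigma>"
  shows "vertex_sign v (insert u \<sigma>) = (if u < v then - vertex_sign v \<sigma> else vertex_sign v \<sigma>)"
proof (cases "u < v")
  case True
  then have "{x \<in> insert u \<sigma>. x < v} = insert u {x \<in> \<sigma>. x < v}" by auto
  then show ?thesis
    using assms True by (simp add: vertex_sign_def)
next
  case False
  then have "{x \<in> insert u \<sigma>. x < v} = {x \<in> \<sigma>. x < v}" by auto
  then show ?thesis
    using False by (simp add: vertex_sign_def)
qed

lemma lookup_eq_0: "c \<in> simplicial_chains k K \<Longrightarrow> \<sigma> \<notin> K \<or> card \<sigma> \<noteq> k \<Longrightarrow> Poly_Mapping.lookup c \<sigma> = 0"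
  by (auto simp: simplicial_chains_def in_keys_iff)

lemma simplicial_chainsI:
  "(\<And>\<sigma>. Poly_Mapping.lookup c \<sigma> \<noteq> 0 \<Longrightarrow> \<sigma> \<in> K \<and> card \<sigma> = k) \<Longrightarrow> c \<in> simplicial_chains k K"
  by (auto simp: simplicial_chains_def in_keys_iff)

lemma simplicial_chains_0 [simp]: "0 \<in> simplicial_chains k K"
  and simplicial_chains_add: "a \<in> simplicial_chains k K \<Longrightarrow> b \<in> simplicial_chains k K \<Longrightarrow> a + b \<in> simplicial_chains k K"
  and simplicial_chains_minus: "a \<in> simplicial_chains k K \<Longrightarrow> - a \<in> simplicial_chains k K"
  and simplicial_chains_diff: "a \<in> simplicial_chains k K \<Longrightarrow> b \<in> simplicial_chains k K \<Longrightarrow> a - b \<in> simplicial_chains k K"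
  and simplicial_chains_cmul: "a \<in> simplicial_chains k K \<Longrightarrow> frag_cmul n a \<in> simplicial_chains k K"
  and simplicial_chains_sum: "(\<And>i. i \<in> I \<Longrightarrow> f i \<in> simplicial_chains k K) \<Longrightarrow> sum f I \<in> simplicial_chains k K"
proof -
  show add: "a \<in> simplicial_chains k K \<Longrightarrow> b \<in> simplicial_chains k K \<Longrightarrow> a + b \<in> simplicial_chains k K" for a b
    unfolding simplicial_chains_def using keys_add[of a b] by blast
  show "a \<in> simplicial_chains k K \<Longrightarrow> b \<in> simplicial_chains k K \<Longrightarrow> a - b \<in> simplicial_chains k K"
    unfolding simplicial_chains_def using keys_diff[of a b] by blast
  show "a \<in> simplicial_chains k K \<Longrightarrow> frag_cmul n a \<in> simplicial_chains k K"
    unfolding simplicial_chains_def using keys_cmul[of n a] by blast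
  show "(\<And>i. i \<in> I \<Longrightarrow> f i \<in> simplicial_chains k K) \<Longrightarrow> sum f I \<in> simplicial_chains k K"
    by (induction I rule: infinite_finite_induct) (simp_all add: add, simp_all add: simplicial_chains_def)
qed (auto simp: simplicial_chains_def)

lemma link_part_self [simp]: "link_part v (link_part v c) = 0"
  by (rule poly_mapping_eqI) (simp add: lookup_link_part)

text \<open>Of two distinct vertices of a simplex exactly one is below the other. Removing the lower
  one first flips the sign belonging to the upper one; removing the upper one first changes
  nothing.\<close>

lemma link_part_anticommute:
  assumes K: "ordered_complex K" and c: "c \<in> simplicial_chains k K"
  shows "link_part u (link_part v c) = - link_part v (link_part u c)"
proof (cases "u = v")
  case False
  show ?thesis
  proof (rule poly_mapping_eqI)
    fix \<tau>
    show "Poly_Mapping.lookup (link_part u (link_part v c)) \<tau> =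
        Poly_Mapping.lookup (- link_part v (link_part u c)) \<tau>"
    \<comment> \<open>Outside this case both coefficients are zero.\<close>
    proof (cases "u \<notin> \<tau> \<and> v \<notin> \<tau> \<and> Poly_Mapping.lookup c (insert u (insert v \<tau>)) \<noteq> 0")
      case True
      then have *: "insert u (insert v \<tau>) \<in> K"
        using lookup_eq_0 c by blast
      have "u \<le> v \<or> v \<le> u"
        by (rule ordered_complex_comparable[OF K *]) auto
      then have "u < v \<and> \<not> v < u \<or> v < u \<and> \<not> u < v"
        using False by auto
      moreover have "finite \<tau>"
        using ordered_complex_finite[OF K *] by simp
      ultimately have "(u < v) = (\<not> v < u)" "finite \<tau>"
        by auto
      with True False show ?thesis
        by (auto simp: lookup_link_part vertex_sign_insert insert_commute)
    qed (use False in \<open>auto simp: lookup_link_part insert_commute\<close>)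
  qed
qed simp

lemma boundary_chain_eq_sum:
  assumes "ordered_complex K" "c \<in> simplicial_chains k K"
  shows "simplicial_boundary c = (\<Sum>v\<in>\<Union>K. link_part v c)"
  using assms by (intro boundary_eq_sum_link_part) (auto simp: ordered_complex_def simplicial_chains_def)

lemma link_part_in_link:
  assumes K: "ordered_complex K" and c: "c \<in> simplicial_chains (Suc k) K"
  shows "link_part v c \<in> simplicial_chains k (link K {v})"
proof (rule simplicial_chainsI)
  fix \<sigma> assume "Poly_Mapping.lookup (link_part v c) \<sigma> \<noteq> 0"
  then have "v \<notin> \<sigma>" "Poly_Mapping.lookup c (insert v \<sigma>) \<noteq> 0"
    by (auto simp: lookup_link_part split: if_splits)
  then have *: "insert v \<sigma> \<in> K" "card (insert v \<sigma>) = Suc k"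
    using lookup_eq_0[OF c] by auto
  with \<open>v \<notin> \<sigma>\<close> show "\<sigma> \<in> link K {v} \<and> card \<sigma> = k"
    using ordered_complex_subset[OF K *(1), of \<sigma>] ordered_complex_finite[OF K *(1)]
    by (auto simp: link_def)
qed

lemma simplicial_chains_mono: "K \<subseteq> L \<Longrightarrow> simplicial_chains k K \<subseteq> simplicial_chains k L"
  by (auto simp: simplicial_chains_def)

lemma link_subset: "link K \<sigma> \<subseteq> K"
  by (auto simp: link_def)

lemma link_part_in_chains:
  assumes "ordered_complex K" "c \<in> simplicial_chains (Suc k) K"
  shows "link_part v c \<in> simplicial_chains k K"
  using link_part_in_link[OF assms] simplicial_chains_mono[OF link_subset] by blast

lemma boundary_in_chains:
  assumes "ordered_complex K" "c \<in> simplicial_chains (Suc k) K"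
  shows "simplicial_boundary c \<in> simplicial_chains k K"
  using assms by (simp add: boundary_chain_eq_sum simplicial_chains_sum link_part_in_chains)

lemma boundary_chain_0:
  assumes "ordered_complex K" "c \<in> simplicial_chains 0 K"
  shows "simplicial_boundary c = 0"
proof -
  have "link_part v c = 0" for v
  proof (rule poly_mapping_eqI)
    fix \<tau>
    have "Poly_Mapping.lookup c (insert v \<tau>) = 0"
      using lookup_eq_0[OF assms(2), of "insert v \<tau>"] ordered_complex_finite[OF assms(1), of "insert v \<tau>"]
      by (auto simp: card_eq_0_iff)
    then show "Poly_Mapping.lookup (link_part v c) \<tau> = Poly_Mapping.lookup 0 \<tau>"
      by (simp add: lookup_link_part)
  qed
  then show ?thesis
    using assms by (simp add: boundary_chain_eq_sum)
qed

text \<open>Anticommutation, summed over all omitted vertices \<open>u\<close>. Up to sign, taking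
  the part at \<open>v\<close> is thus a chain map from the complex to the link of \<open>v\<close>,
  of degree \<open>-1\<close>.\<close>

lemma link_part_boundary:
  assumes K: "ordered_complex K" and c: "c \<in> simplicial_chains k K"
  shows "link_part v (simplicial_boundary c) = - simplicial_boundary (link_part v c)"
proof (cases k)
  case 0
  then have "link_part v c = 0"
    using c lookup_eq_0[OF c] ordered_complex_finite[OF K]
    by (intro poly_mapping_eqI) (auto simp: lookup_link_part card_eq_0_iff)
  then show ?thesis
    using 0 K c by (simp add: boundary_chain_0)
next
  case (Suc j)
  have "link_part v (simplicial_boundary c) = (\<Sum>u\<in>\<Union>K. link_part v (link_part u c))"
    using K c by (simp add: boundary_chain_eq_sum link_part_sum ordered_complex_def)
  also have "\<dots> = - (\<Sum>u\<in>\<Union>K. link_part u (link_part v c))"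
    by (simp add: link_part_anticommute[OF K c, of v] sum_negf)
  also have "\<dots> = - simplicial_boundary (link_part v c)"
    using K c Suc by (simp add: boundary_chain_eq_sum[OF K link_part_in_chains])
  finally show ?thesis .
qed

lemma boundary_boundary:
  assumes K: "ordered_complex K" and c: "c \<in> simplicial_chains k K"
  shows "simplicial_boundary (simplicial_boundary c) = 0"
proof (cases k)
  case (Suc j)
  have fin: "finite (\<Union>K)"
    using K by (simp add: ordered_complex_def)
  have "simplicial_boundary (simplicial_boundary c) =
      (\<Sum>u\<in>\<Union>K. link_part u (simplicial_boundary c))"
    using K c Suc by (intro boundary_chain_eq_sum boundary_in_chains) auto
  also have "\<dots> = (\<Sum>u\<in>\<Union>K. \<Sum>v\<in>\<Union>K. link_part u (link_part v c))"
    using fin by (simp add: boundary_chain_eq_sum[OF K c] link_part_sum)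
  also have "\<dots> = 0"
  proof (rule poly_mapping_eqI)
    fix \<tau>
    show "Poly_Mapping.lookup (\<Sum>u\<in>\<Union>K. \<Sum>v\<in>\<Union>K. link_part u (link_part v c)) \<tau> = Poly_Mapping.lookup 0 \<tau>"
      unfolding lookup_sum lookup_zero
      \<comment> \<open>The summand is antisymmetric in the two omitted vertices; the summation
        lemma is about integers, so it is applied to each coefficient.\<close>
      by (rule sum_antisymmetric) (subst link_part_anticommute[OF K c], simp)
  qed
  finally show ?thesis .
qed (use K c in \<open>simp add: boundary_chain_0\<close>)

section \<open>Links and cones over chains of a link\<close>

lemma ordered_complex_link:
  assumes "ordered_complex K" "\<sigma> \<in> K"
  shows "ordered_complex (link K \<sigma>)"
proof -
  have "\<Union>(link K \<sigma>) \<subseteq> \<Union>K"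
    by (auto simp: link_def)
  moreover have "\<tau>' \<in> link K \<sigma>" if "\<tau> \<in> link K \<sigma>" "\<tau>' \<subseteq> \<tau>" for \<tau> \<tau>'
  proof -
    have "\<tau>' \<in> K"
      using that ordered_complex_subset[OF assms(1), of \<tau> \<tau>'] by (auto simp: link_def)
    moreover have "\<tau>' \<union> \<sigma> \<in> K"
      using that ordered_complex_subset[OF assms(1), of "\<tau> \<union> \<sigma>" "\<tau>' \<union> \<sigma>"] by (auto simp: link_def)
    ultimately show ?thesis
      using that by (auto simp: link_def)
  qed
  moreover have "finite (\<Union>K)" and "Complete_Partial_Order.chain (\<le>) \<tau>" if "\<tau> \<in> K" for \<tau>
    using assms that unfolding ordered_complex_def by blast+
  moreover have "{} \<in> link K \<sigma>"
    using assms by (simp add: link_def ordered_complex_def)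
  ultimately show ?thesis
    using link_subset[of K \<sigma>] \<open>\<sigma> \<in> K\<close> unfolding ordered_complex_def
    by (metis finite_subset subsetD)
qed

lemma link_link:
  assumes "ordered_complex K" "\<tau> \<in> link K \<sigma>"
  shows "link (link K \<sigma>) \<tau> = link K (\<sigma> \<union> \<tau>)"
proof -
  have "\<rho> \<union> \<tau> \<in> K" "\<rho> \<union> \<sigma> \<in> K" if "\<rho> \<union> (\<sigma> \<union> \<tau>) \<in> K" for \<rho>
    using ordered_complex_subset[OF assms(1) that] by auto
  then show ?thesis
    using assms(2) by (auto simp: link_def Un_ac)
qed

text \<open>The cone with apex \<open>v\<close>: each simplex \<open>\<sigma>\<close> of the link is
  replaced by \<open>insert v \<sigma>\<close>, with the sign that cancels the one in
  \<open>link_part\<close>.\<close>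

lemma link_part_lift:
  assumes K: "ordered_complex K" and l: "l \<in> simplicial_chains k (link K {v})"
  obtains e where "e \<in> simplicial_chains (Suc k) K" "link_part v e = l"
proof -
  have "Poly_Mapping.keys l \<subseteq> {\<sigma> \<in> link K {v}. card \<sigma> = k}"
    using l by (simp add: simplicial_chains_def)
  then have "\<exists>e\<in>simplicial_chains (Suc k) K. link_part v e = l"
  proof (induction l rule: frag_induction)
    case zero
    then show ?case by (intro bexI[of _ 0]) auto
  next
    case (one \<sigma>)
    define e where "e = frag_cmul (vertex_sign v \<sigma>) (frag_of (insert v \<sigma>))"
    have \<sigma>: "v \<notin> \<sigma>" "insert v \<sigma> \<in> K" "card \<sigma> = k"
      using one by (auto simp: link_def)
    then have "frag_of (insert v \<sigma>) \<in> simplicial_chains (Suc k) K"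
      using ordered_complex_finite[OF K \<sigma>(2)] by (auto simp: simplicial_chains_def)
    then have "e \<in> simplicial_chains (Suc k) K"
      unfolding e_def by (rule simplicial_chains_cmul)
    moreover have "link_part v e = frag_of \<sigma>"
      using \<sigma>(1) by (simp add: e_def link_part_cmul) (simp add: link_part_def frag_cmul_cmul)
    ultimately show ?case by blast
  next
    case (diff a b)
    then show ?case
      by (metis link_part_diff simplicial_chains_diff)
  qed
  then show thesis
    using that by blast
qed

subsection \<open>Complexes all of whose links are homology spheres\<close>

definition cycles :: "nat \<Rightarrow> 'a::order set set \<Rightarrow> ('a set \<Rightarrow>\<^sub>0 int) set"
  where "cycles k K = {c \<in> simplicial_chains k K. simplicial_boundary c = 0}"

text \<open>Vanishing of reduced homology in dimension \<open>k - 1\<close>.\<close>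

definition exact_at :: "nat \<Rightarrow> 'a::order set set \<Rightarrow> bool"
  where "exact_at k K \<longleftrightarrow> cycles k K \<subseteq> simplicial_boundary ` simplicial_chains (Suc k) K"

text \<open>The homology of the sphere of dimension \<open>m - 1\<close>. It is meant for complexes
  whose simplices have at most \<open>m\<close> vertices: there the top homology is the group of
  cycles itself, and being generated by a non-zero chain makes it infinite cyclic.\<close>

definition sphere_homology :: "nat \<Rightarrow> 'a::order set set \<Rightarrow> bool"
  where "sphere_homology m K \<longleftrightarrow> (\<forall>k. k \<noteq> m \<longrightarrow> exact_at k K) \<and>
    (\<exists>g\<in>cycles m K. g \<noteq> 0 \<and> cycles m K \<subseteq> range (\<lambda>n. frag_cmul n g))"

text \<open>The case \<open>\<sigma> = {}\<close> is the condition on \<open>K\<close> itself. The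
  number \<open>m\<close> counts the vertices of a facet, so \<open>m = 0\<close> stands for the
  empty sphere; the bound on \<open>card \<sigma>\<close> keeps \<open>m - card \<sigma>\<close>
  from being truncated.\<close>

definition homology_sphere_complex :: "nat \<Rightarrow> 'a::order set set \<Rightarrow> bool"
  where "homology_sphere_complex m K \<longleftrightarrow> ordered_complex K \<and>
    (\<forall>\<sigma>\<in>K. card \<sigma> \<le> m \<and> sphere_homology (m - card \<sigma>) (link K \<sigma>))"

lemma cycles_diff: "a \<in> cycles k K \<Longrightarrow> b \<in> cycles k K \<Longrightarrow> a - b \<in> cycles k K"
  and cycles_cmul: "a \<in> cycles k K \<Longrightarrow> frag_cmul n a \<in> cycles k K"
  and cycles_minus: "a \<in> cycles k K \<Longrightarrow> - a \<in> cycles k K"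
  by (simp_all add: cycles_def simplicial_chains_diff simplicial_chains_cmul simplicial_chains_minus
      boundary_diff boundary_cmul boundary_minus)

lemma link_part_cycle:
  assumes K: "ordered_complex K" and z: "z \<in> cycles (Suc k) K"
  shows "link_part v z \<in> cycles k (link K {v})"
proof -
  have "simplicial_boundary (link_part v z) = 0"
    using link_part_boundary[OF K, of z "Suc k" v] z by (simp add: cycles_def)
  then show ?thesis
    using z link_part_in_link[OF K] by (simp add: cycles_def)
qed

lemma link_empty [simp]: "link K {} = K"
  by (auto simp: link_def)

text \<open>A link in a link is the link of the union of two disjoint simplices, whose cardinalities
  add up. This permits induction on \<open>m\<close>.\<close>

lemma homology_sphere_complex_link:
  assumes hs: "homology_sphere_complex m K" and "\<sigma> \<in> K"
  shows "homology_sphere_complex (m - card \<sigma>) (link K \<sigma>)"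
  unfolding homology_sphere_complex_def
proof (intro conjI ballI)
  have K: "ordered_complex K"
    using hs by (simp add: homology_sphere_complex_def)
  then show "ordered_complex (link K \<sigma>)"
    using \<open>\<sigma> \<in> K\<close> by (rule ordered_complex_link)
  fix \<tau> assume \<tau>: "\<tau> \<in> link K \<sigma>"
  then have \<tau>K: "\<sigma> \<union> \<tau> \<in> K" and disj: "\<sigma> \<inter> \<tau> = {}"
    by (auto simp: link_def Un_commute)
  have card: "card (\<sigma> \<union> \<tau>) = card \<sigma> + card \<tau>"
    using ordered_complex_finite[OF K \<tau>K] disj by (intro card_Un_disjoint) auto
  have "card (\<sigma> \<union> \<tau>) \<le> m" "sphere_homology (m - card (\<sigma> \<union> \<tau>)) (link K (\<sigma> \<union> \<tau>))"
    using hs \<tau>K by (auto simp: homology_sphere_complex_def)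
  then show "card \<tau> \<le> m - card \<sigma>" "sphere_homology (m - card \<sigma> - card \<tau>) (link (link K \<sigma>) \<tau>)"
    unfolding link_link[OF K \<tau>] card by auto
qed

lemma homology_sphere_complex_sphere_homology:
  assumes "homology_sphere_complex m K"
  shows "sphere_homology m K"
proof -
  have "{} \<in> K"
    using assms by (auto simp: homology_sphere_complex_def ordered_complex_def)
  then show ?thesis
    using assms unfolding homology_sphere_complex_def by force
qed

section \<open>Facets, purity and top-dimensional cycles\<close>

lemma homology_sphere_complex_facet_exists:
  assumes "homology_sphere_complex m K"
  shows "\<exists>\<sigma>\<in>K. card \<sigma> = m"
proof -
  obtain g where "g \<in> cycles m K" "g \<noteq> 0"
    using homology_sphere_complex_sphere_homology[OF assms] by (auto simp: sphere_homology_def)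
  then obtain \<sigma> where "Poly_Mapping.lookup g \<sigma> \<noteq> 0"
    by (metis lookup_zero poly_mapping_eqI)
  with \<open>g \<in> cycles m K\<close> show ?thesis
    using lookup_eq_0 unfolding cycles_def by blast
qed

text \<open>The link of \<open>\<sigma>\<close> carries a non-zero cycle in its own top degree,
  hence has a facet; joining this facet to \<open>\<sigma>\<close> gives
  \<open>\<rho>\<close>.\<close>

lemma homology_sphere_complex_pure:
  assumes hs: "homology_sphere_complex m K" and \<sigma>: "\<sigma> \<in> K"
  obtains \<rho> where "\<rho> \<in> K" "card \<rho> = m" "\<sigma> \<subseteq> \<rho>"
proof -
  obtain \<tau> where \<tau>: "\<tau> \<in> link K \<sigma>" "card \<tau> = m - card \<sigma>"
    using homology_sphere_complex_facet_exists[OF homology_sphere_complex_link[OF hs \<sigma>]] by blast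
  have K: "ordered_complex K" and "card \<sigma> \<le> m"
    using hs \<sigma> by (auto simp: homology_sphere_complex_def)
  moreover have "\<tau> \<union> \<sigma> \<in> K" "\<tau> \<inter> \<sigma> = {}"
    using \<tau> by (auto simp: link_def)
  moreover have "card (\<tau> \<union> \<sigma>) = card \<tau> + card \<sigma>"
    using ordered_complex_finite[OF K] calculation by (intro card_Un_disjoint) auto
  ultimately show thesis
    using \<tau> by (intro that[of "\<tau> \<union> \<sigma>"]) auto
qed

text \<open>Under the augmentation every vertex has the empty simplex as its boundary, so the two
  terms cancel.\<close>

lemma vertex_difference_cycle:
  assumes K: "ordered_complex K" and "{u} \<in> K" "{v} \<in> K"
  shows "frag_of {u} - frag_of {v} \<in> cycles 1 K"
proof -
  have "simplicial_boundary (frag_of {x}) = frag_of {}" for x :: 'a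
  proof -
    have "card {u \<in> {x}. u < x} = 0" by auto
    then show ?thesis by (simp add: simplicial_boundary_def del: insert_iff card_eq_0_iff card_0_eq)
  qed
  moreover have "frag_of {u} \<in> simplicial_chains 1 K" "frag_of {v} \<in> simplicial_chains 1 K"
    using assms by (auto simp: simplicial_chains_def)
  ultimately show ?thesis
    by (simp add: cycles_def boundary_diff simplicial_chains_diff)
qed

text \<open>The difference of the two vertices bounds a combination \<open>b\<close> of edges.
  Pairing \<open>f\<close> with its boundary gives \<open>f u - f v\<close>, while each edge
  contributes zero because its ends have opposite signs and equal values of
  \<open>f\<close>.\<close>

lemma locally_constant_imp_constant:
  fixes f :: "'a::order \<Rightarrow> int"
  assumes K: "ordered_complex K" and exact: "exact_at 1 K"
    and f: "\<And>x y. {x, y} \<in> K \<Longrightarrow> f x = f y"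
    and u: "{u} \<in> K" and v: "{v} \<in> K"
  shows "f u = f v"
proof -
  have fin: "finite (\<Union>K)" and uv: "u \<in> \<Union>K" "v \<in> \<Union>K"
    using K u v by (auto simp: ordered_complex_def)
  obtain b where b: "b \<in> simplicial_chains 2 K" "simplicial_boundary b = frag_of {u} - frag_of {v}"
    using exact vertex_difference_cycle[OF K u v] unfolding exact_at_def Suc_1 by force
  \<comment> \<open>\<open>F x y\<close> is the contribution to this pairing made at the vertex
    \<open>x\<close> by the edge from \<open>x\<close> to \<open>y\<close>.\<close>
  define F where "F x y = f x * Poly_Mapping.lookup (link_part y b) {x}" for x y
  have F: "F x y = (if x = y then 0 else f x * (vertex_sign y {x} * Poly_Mapping.lookup b {x, y}))" for x y
    unfolding F_def lookup_link_part insert_commute[of y x] by simp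
  have "F x y = - F y x" for x y
  proof (cases "x \<noteq> y \<and> {x, y} \<in> K")
    case True
    then have "x \<le> y \<or> y \<le> x"
      using ordered_complex_comparable[OF K, of "{x, y}" x y] by auto
    then have "x < y \<and> \<not> y < x \<or> y < x \<and> \<not> x < y"
      using True by auto
    then have "vertex_sign y {x} = - vertex_sign x {y}"
      using vertex_sign_insert[of "{}" x y] vertex_sign_insert[of "{}" y x] True
      by (auto simp: vertex_sign_def)
    moreover have "f y = f x"
      using True f[of x y] by simp
    ultimately show ?thesis
      unfolding F insert_commute[of y x] by simp
  next
    case False
    then show ?thesis
      using lookup_eq_0[OF b(1), of "{x, y}"] unfolding F insert_commute[of y x] by auto
  qed
  then have "(\<Sum>x\<in>\<Union>K. \<Sum>y\<in>\<Union>K. F x y) = 0"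
    by (intro sum_antisymmetric)
  moreover have "(\<Sum>y\<in>\<Union>K. F x y) = f x * Poly_Mapping.lookup (simplicial_boundary b) {x}" for x
    by (simp add: boundary_chain_eq_sum[OF K b(1)] lookup_sum F_def sum_distrib_left)
  moreover have "f x * Poly_Mapping.lookup (frag_of {u} - frag_of {v}) {x} =
      (if x = u then f x else 0) - (if x = v then f x else 0)" for x
    by (auto simp: lookup_minus)
  ultimately show ?thesis
    using fin uv by (simp add: b(2) sum_subtractf)
qed

text \<open>A coefficient of \<open>z\<close> is an integer multiple of that of \<open>g\<close>,
  and only units divide a unit.\<close>

lemma generator_abs_1:
  assumes "cycles k K \<subseteq> range (\<lambda>n. frag_cmul n g)"
    and "z \<in> cycles k K" "\<bar>Poly_Mapping.lookup z \<sigma>\<bar> = 1"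
  shows "\<bar>Poly_Mapping.lookup g \<sigma>\<bar> = 1"
proof -
  obtain n where "z = frag_cmul n g"
    using assms by blast
  then have "\<bar>n\<bar> * \<bar>Poly_Mapping.lookup g \<sigma>\<bar> = 1"
    using assms(3) by (simp add: abs_mult)
  then show ?thesis
    by (auto simp: zmult_eq_1_iff)
qed

text \<open>
  Induction over vertex links makes the absolute coefficient constant on the facets through a given
  vertex, hence a locally constant function of the vertex; vanishing of the reduced homology in
  dimension 0 makes it constant. For \<open>m = 1\<close> that homology is \<open>\<int>\<close> instead, and differences of two
  vertices force the coefficients of a generator to be units.
\<close>

lemma top_cycle_abs_constant:
  assumes "homology_sphere_complex m K" "z \<in> cycles m K"
    and "\<sigma> \<in> K" "card \<sigma> = m" "\<tau> \<in> K" "card \<tau> = m"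
  shows "\<bar>Poly_Mapping.lookup z \<sigma>\<bar> = \<bar>Poly_Mapping.lookup z \<tau>\<bar>"
  using assms
proof (induction m arbitrary: K z \<sigma> \<tau>)
  case 0
  then have K: "ordered_complex K"
    by (simp add: homology_sphere_complex_def)
  have "\<sigma> = {}" "\<tau> = {}"
    using 0 ordered_complex_finite[OF K] by (auto simp: card_eq_0_iff)
  then show ?case by simp
next
  case (Suc m)
  have K: "ordered_complex K"
    using Suc.prems by (simp add: homology_sphere_complex_def)
  have sph: "sphere_homology (Suc m) K"
    using Suc.prems homology_sphere_complex_sphere_homology by blast
  have vertex: "{v} \<in> K" if "v \<in> \<rho>" "\<rho> \<in> K" for v \<rho>
    using ordered_complex_subset[OF K that(2)] that(1) by auto
  have local: "\<bar>Poly_Mapping.lookup z \<rho>\<bar> = \<bar>Poly_Mapping.lookup z \<rho>'\<bar>"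
    if "v \<in> \<rho>" "v \<in> \<rho>'" "\<rho> \<in> K" "\<rho>' \<in> K" "card \<rho> = Suc m" "card \<rho>' = Suc m" for v \<rho> \<rho>'
  proof -
    have "{v} \<in> K"
      using vertex that by blast
    from homology_sphere_complex_link[OF Suc.prems(1) this]
    have hs: "homology_sphere_complex m (link K {v})" by simp
    have part: "\<bar>Poly_Mapping.lookup z \<alpha>\<bar> = \<bar>Poly_Mapping.lookup (link_part v z) (\<alpha> - {v})\<bar>"
      and mem: "\<alpha> - {v} \<in> link K {v}" "card (\<alpha> - {v}) = m"
      if "v \<in> \<alpha>" "\<alpha> \<in> K" "card \<alpha> = Suc m" for \<alpha>
    proof -
      show "\<bar>Poly_Mapping.lookup z \<alpha>\<bar> = \<bar>Poly_Mapping.lookup (link_part v z) (\<alpha> - {v})\<bar>"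
        using that by (simp add: lookup_link_part abs_mult insert_absorb)
      show "\<alpha> - {v} \<in> link K {v}"
        using that ordered_complex_subset[OF K that(2), of "\<alpha> - {v}"]
        by (auto simp: link_def insert_absorb)
      show "card (\<alpha> - {v}) = m"
        using that ordered_complex_finite[OF K that(2)] by simp
    qed
    show ?thesis
      using part mem that
      by (metis Suc.IH[OF hs link_part_cycle[OF K Suc.prems(2)]])
  qed
  have "\<sigma> \<noteq> {}" "\<tau> \<noteq> {}"
    using Suc.prems by auto
  then obtain u v where uv: "u \<in> \<sigma>" "v \<in> \<tau>" by blast
  show ?case
  proof (cases "m = 0")
    case True
    obtain g where g: "g \<in> cycles 1 K" "cycles 1 K \<subseteq> range (\<lambda>n. frag_cmul n g)"
      using sph True by (auto simp: sphere_homology_def)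
    have \<sigma>\<tau>: "\<sigma> = {u}" "\<tau> = {v}"
      using Suc.prems True uv by (auto simp: card_1_singleton_iff)
    show ?thesis
    proof (cases "u = v")
      case False
      have c: "frag_of {u} - frag_of {v} \<in> cycles 1 K"
        using Suc.prems \<sigma>\<tau> by (intro vertex_difference_cycle[OF K]) auto
      have "\<bar>Poly_Mapping.lookup g \<sigma>\<bar> = 1" "\<bar>Poly_Mapping.lookup g \<tau>\<bar> = 1"
        using \<sigma>\<tau> False by (auto intro!: generator_abs_1[OF g(2) c] simp: lookup_minus)
      moreover obtain n where "z = frag_cmul n g"
        using g(2) Suc.prems(2) True by auto
      ultimately show ?thesis by (simp add: abs_mult)
    qed (use \<sigma>\<tau> in simp)
  next
    case False
    define f where "f w = \<bar>Poly_Mapping.lookup z (SOME \<rho>. \<rho> \<in> K \<and> w \<in> \<rho> \<and> card \<rho> = Suc m)\<bar>" for w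
    have f: "f w = \<bar>Poly_Mapping.lookup z \<rho>\<bar>" if "\<rho> \<in> K" "w \<in> \<rho>" "card \<rho> = Suc m" for w \<rho>
    proof -
      have "\<exists>\<rho>. \<rho> \<in> K \<and> w \<in> \<rho> \<and> card \<rho> = Suc m"
        using that by blast
      from someI_ex[OF this] show ?thesis
        unfolding f_def using that by (intro local[of w]) auto
    qed
    have "exact_at 1 K"
      using sph False by (simp add: sphere_homology_def)
    moreover have "f x = f y" if xy: "{x, y} \<in> K" for x y
    proof -
      \<comment> \<open>By purity the two vertices lie in a common facet, and this one facet
        computes both \<open>f x\<close> and \<open>f y\<close>.\<close>
      obtain \<rho> where "\<rho> \<in> K" "card \<rho> = Suc m" "{x, y} \<subseteq> \<rho>"
        using homology_sphere_complex_pure[OF Suc.prems(1) xy] by blast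
      then show ?thesis using f[of \<rho> x] f[of \<rho> y] by simp
    qed
    moreover have "{u} \<in> K" "{v} \<in> K"
      using vertex uv Suc.prems by blast+
    ultimately have "f u = f v"
      using locally_constant_imp_constant[OF K] by blast
    then show ?thesis
      using f uv Suc.prems by simp
  qed
qed

lemma top_cycle_vanishing:
  assumes "homology_sphere_complex m K" "z \<in> cycles m K"
    and "\<sigma> \<in> K" "card \<sigma> = m" "Poly_Mapping.lookup z \<sigma> = 0"
  shows "z = 0"
proof (rule poly_mapping_eqI)
  fix \<tau>
  have "z \<in> simplicial_chains m K"
    using assms by (simp add: cycles_def)
  then show "Poly_Mapping.lookup z \<tau> = Poly_Mapping.lookup 0 \<tau>"
    using top_cycle_abs_constant[OF assms(1-4), of \<tau>] assms(5) lookup_eq_0[of z m K \<tau>] by auto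
qed

text \<open>All coefficients of a generator on facets are \<open>a\<close> or \<open>-a\<close> for
  one \<open>a > 0\<close>. Dividing by \<open>a\<close> yields a chain with unit coefficients,
  which is still a cycle because chain groups are torsion-free.\<close>

lemma fundamental_cycle:
  assumes hs: "homology_sphere_complex m K"
  obtains \<mu> where "\<mu> \<in> cycles m K"
    "\<And>\<sigma>. \<sigma> \<in> K \<Longrightarrow> card \<sigma> = m \<Longrightarrow> \<bar>Poly_Mapping.lookup \<mu> \<sigma>\<bar> = 1"
proof -
  obtain g where g: "g \<in> cycles m K" "g \<noteq> 0" "cycles m K \<subseteq> range (\<lambda>n. frag_cmul n g)"
    using homology_sphere_complex_sphere_homology[OF hs] by (auto simp: sphere_homology_def)
  obtain \<sigma> where \<sigma>: "\<sigma> \<in> K" "card \<sigma> = m"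
    using homology_sphere_complex_facet_exists[OF hs] by blast
  define a where "a = \<bar>Poly_Mapping.lookup g \<sigma>\<bar>"
  have a: "\<bar>Poly_Mapping.lookup g \<tau>\<bar> = a" if "\<tau> \<in> K" "card \<tau> = m" for \<tau>
    unfolding a_def using top_cycle_abs_constant[OF hs g(1) that \<sigma>] .
  have "0 \<le> a"
    by (simp add: a_def)
  have "a \<noteq> 0"
    using top_cycle_vanishing[OF hs g(1) \<sigma>] g(2) by (auto simp: a_def)
  define h where "h = Poly_Mapping.map (\<lambda>n. n div a) g"
  have gh: "g = frag_cmul a h"
  proof (rule poly_mapping_eqI)
    fix \<tau>
    have "a dvd Poly_Mapping.lookup g \<tau>"
    proof (cases "\<tau> \<in> K \<and> card \<tau> = m")
      case True
      then show ?thesis using a[of \<tau>] by (metis abs_dvd_iff dvd_abs_iff dvd_refl)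
    next
      case False
      then show ?thesis using g(1) lookup_eq_0[of g m K \<tau>] by (auto simp: cycles_def)
    qed
    then show "Poly_Mapping.lookup g \<tau> = Poly_Mapping.lookup (frag_cmul a h) \<tau>"
      by (simp add: h_def map.rep_eq when_def)
  qed
  have "h \<in> cycles m K"
  proof -
    have "h \<in> simplicial_chains m K"
      using g(1) by (auto simp: cycles_def h_def map.rep_eq when_def intro!: simplicial_chainsI dest: lookup_eq_0 split: if_splits)
    moreover have "frag_cmul a (simplicial_boundary h) = 0"
      using g(1) by (simp add: cycles_def gh flip: boundary_cmul)
    then have "simplicial_boundary h = 0"
      using \<open>a \<noteq> 0\<close> by (auto simp: poly_mapping_eq_iff fun_eq_iff)
    ultimately show ?thesis by (simp add: cycles_def)
  qed
  moreover have "\<bar>Poly_Mapping.lookup h \<tau>\<bar> = 1" if "\<tau> \<in> K" "card \<tau> = m" for \<tau>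
  proof -
    have "\<bar>a\<bar> * \<bar>Poly_Mapping.lookup h \<tau>\<bar> = \<bar>a\<bar> * 1"
      using a[OF that] \<open>0 \<le> a\<close> by (simp add: gh abs_mult)
    then show ?thesis using \<open>a \<noteq> 0\<close> by simp
  qed
  ultimately show thesis by (rule that)
qed

section \<open>Deleting a vertex\<close>

definition deletion :: "'a set set \<Rightarrow> 'a \<Rightarrow> 'a set set"
  where "deletion K v = {\<sigma> \<in> K. v \<notin> \<sigma>}"

text \<open>Below the top degree \<open>l\<close> bounds in the link, and the boundary of a cone
  over a bounding chain restricts to \<open>l\<close> up to sign. In the top degree a multiple of
  the fundamental cycle does it, since a top cycle of the link vanishes once one facet coefficient
  does.\<close>

lemma link_cycle_lift:
  assumes hs: "homology_sphere_complex m K" and v: "{v} \<in> K"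
    and l: "l \<in> cycles k (link K {v})"
  obtains y where "y \<in> cycles (Suc k) K" "link_part v y = l"
proof (cases "m = Suc k")
  case False
  have K: "ordered_complex K"
    using hs by (simp add: homology_sphere_complex_def)
  \<comment> \<open>Without truncation in \<open>m - 1\<close>, the case assumption says that
    \<open>k\<close> is not the top degree of the link.\<close>
  have "1 \<le> m"
    using hs v unfolding homology_sphere_complex_def by force
  have "exact_at k (link K {v})"
    using homology_sphere_complex_sphere_homology[OF homology_sphere_complex_link[OF hs v]] False \<open>1 \<le> m\<close>
    by (simp add: sphere_homology_def)
  then obtain b where b: "b \<in> simplicial_chains (Suc k) (link K {v})" "simplicial_boundary b = l"
    using l by (auto simp: exact_at_def)
  then obtain e where e: "e \<in> simplicial_chains (Suc (Suc k)) K" "link_part v e = b"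
    using link_part_lift[OF K] by blast
  \<comment> \<open>The minus sign compensates the one in \<open>link_part_boundary\<close>.\<close>
  have "- simplicial_boundary e \<in> cycles (Suc k) K"
    using boundary_in_chains[OF K e(1)] boundary_boundary[OF K e(1)]
    by (intro cycles_minus) (simp add: cycles_def)
  moreover have "link_part v (- simplicial_boundary e) = l"
    using link_part_boundary[OF K e(1), of v] e(2) b(2) by (simp add: link_part_minus)
  ultimately show thesis by (rule that)
next
  case True
  have K: "ordered_complex K"
    using hs by (simp add: homology_sphere_complex_def)
  have hsl: "homology_sphere_complex k (link K {v})"
    using homology_sphere_complex_link[OF hs v] True by simp
  obtain \<tau> where \<tau>: "\<tau> \<in> link K {v}" "card \<tau> = k"
    using homology_sphere_complex_facet_exists[OF hsl] by blast
  obtain \<mu> where \<mu>: "\<mu> \<in> cycles (Suc k) K"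
    "\<And>\<sigma>. \<sigma> \<in> K \<Longrightarrow> card \<sigma> = Suc k \<Longrightarrow> \<bar>Poly_Mapping.lookup \<mu> \<sigma>\<bar> = 1"
    using fundamental_cycle[OF hs] True by blast
  have "v \<notin> \<tau>" "insert v \<tau> \<in> K"
    using \<tau> by (auto simp: link_def)
  moreover have "card (insert v \<tau>) = Suc k"
    using \<tau>(2) \<open>v \<notin> \<tau>\<close> ordered_complex_finite[OF K \<open>insert v \<tau> \<in> K\<close>] by simp
  ultimately have 1: "\<bar>Poly_Mapping.lookup (link_part v \<mu>) \<tau>\<bar> = 1"
    using \<mu>(2) by (simp add: lookup_link_part abs_mult)
  \<comment> \<open>The coefficient of \<open>link_part v \<mu>\<close> at \<open>\<tau>\<close> is
    its own inverse, so this multiple of it agrees with \<open>l\<close> at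
    \<open>\<tau>\<close>.\<close>
  define a where "a = Poly_Mapping.lookup l \<tau> * Poly_Mapping.lookup (link_part v \<mu>) \<tau>"
  have "Poly_Mapping.lookup (link_part v \<mu>) \<tau> * Poly_Mapping.lookup (link_part v \<mu>) \<tau> = 1"
    using 1 by (metis abs_mult_self_eq mult_1)
  then have "Poly_Mapping.lookup (l - frag_cmul a (link_part v \<mu>)) \<tau> = 0"
    by (simp add: a_def lookup_minus mult.assoc)
  moreover have "l - frag_cmul a (link_part v \<mu>) \<in> cycles k (link K {v})"
    using l link_part_cycle[OF K \<mu>(1)] by (intro cycles_diff cycles_cmul)
  ultimately have "l - frag_cmul a (link_part v \<mu>) = 0"
    using top_cycle_vanishing[OF hsl] \<tau> by blast
  then have "link_part v (frag_cmul a \<mu>) = l"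
    by (simp add: link_part_cmul)
  then show thesis
    using that cycles_cmul[OF \<mu>(1)] by blast
qed

text \<open>A chain of \<open>K\<close> bounding \<open>z\<close> can be corrected by a cycle of
  \<open>K\<close> with the same part at \<open>v\<close>; the correction leaves the boundary
  unchanged and removes all simplices through \<open>v\<close>. In the top degree \<open>z\<close>
  itself is zero.\<close>

lemma deletion_exact:
  assumes hs: "homology_sphere_complex m K" and v: "{v} \<in> K"
  shows "exact_at k (deletion K v)"
  unfolding exact_at_def
proof
  fix z assume z: "z \<in> cycles k (deletion K v)"
  have K: "ordered_complex K"
    using hs by (simp add: homology_sphere_complex_def)
  have zv: "Poly_Mapping.lookup z \<sigma> = 0" if "v \<in> \<sigma>" for \<sigma>
    using z that lookup_eq_0[of z k "deletion K v" \<sigma>] by (auto simp: cycles_def deletion_def)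
  have zK: "z \<in> cycles k K"
    using z simplicial_chains_mono[of "deletion K v" K k] by (auto simp: cycles_def deletion_def)
  show "z \<in> simplicial_boundary ` simplicial_chains (Suc k) (deletion K v)"
  proof (cases "k = m")
    case True
    \<comment> \<open>A facet through \<open>v\<close>, on which \<open>z\<close> has coefficient
      zero.\<close>
    obtain \<rho> where "\<rho> \<in> K" "card \<rho> = m" "{v} \<subseteq> \<rho>"
      using homology_sphere_complex_pure[OF hs v] by blast
    then have "z = 0"
      using top_cycle_vanishing[OF hs] zK zv True by blast
    then show ?thesis
      by (intro image_eqI[of _ _ 0]) auto
  next
    case False
    then have "exact_at k K"
      using homology_sphere_complex_sphere_homology[OF hs] by (simp add: sphere_homology_def)
    then obtain b where b: "b \<in> simplicial_chains (Suc k) K" "simplicial_boundary b = z"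
      using zK by (auto simp: exact_at_def)
    \<comment> \<open>As \<open>z\<close> avoids \<open>v\<close>, taking parts at \<open>v\<close>
      in \<open>z = \<partial>b\<close> shows that \<open>link_part v b\<close> is a cycle.\<close>
    have "link_part v z = 0"
      using zv by (intro poly_mapping_eqI) (simp add: lookup_link_part)
    then have "link_part v b \<in> cycles k (link K {v})"
      using link_part_boundary[OF K b(1), of v] link_part_in_link[OF K b(1)] b(2) by (simp add: cycles_def)
    then obtain y where y: "y \<in> cycles (Suc k) K" "link_part v y = link_part v b"
      using link_cycle_lift[OF hs v] by blast
    have by0: "link_part v (b - y) = 0" and byK: "b - y \<in> simplicial_chains (Suc k) K"
      using y b by (simp_all add: link_part_diff cycles_def simplicial_chains_diff)
    have "b - y \<in> simplicial_chains (Suc k) (deletion K v)"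
    proof (rule simplicial_chainsI)
      fix \<sigma> assume nz: "Poly_Mapping.lookup (b - y) \<sigma> \<noteq> 0"
      have "v \<notin> \<sigma>"
      proof
        assume "v \<in> \<sigma>"
        then have "\<bar>Poly_Mapping.lookup (link_part v (b - y)) (\<sigma> - {v})\<bar> = \<bar>Poly_Mapping.lookup (b - y) \<sigma>\<bar>"
          by (simp add: lookup_link_part abs_mult insert_absorb)
        then show False using nz by0 by simp
      qed
      then show "\<sigma> \<in> deletion K v \<and> card \<sigma> = Suc k"
        using lookup_eq_0[OF byK] nz by (auto simp: deletion_def)
    qed
    moreover have "simplicial_boundary (b - y) = z"
      using y b by (simp add: boundary_diff cycles_def)
    ultimately show ?thesis by blast
  qed
qed

subsection \<open>Homology groups and order complexes\<close>

lemma mod_subgroup_group: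
  assumes "comm_group H" "subgroup B H"
  shows "group (H Mod B)"
  by (rule normal.factorgroup_is_group[OF iffD2[OF comm_group.normal_iff_subgroup[OF assms(1)] assms(2)]])

lemma trivial_group_mod_iff:
  assumes "comm_group H" "subgroup B H"
  shows "trivial_group (H Mod B) \<longleftrightarrow> carrier H \<subseteq> B"
proof -
  have H: "group H"
    using assms by (simp add: comm_group_def)
  have "carrier (H Mod B) = {B} \<longleftrightarrow> carrier H \<subseteq> B"
  proof
    assume "carrier (H Mod B) = {B}"
    then have "B #>\<^bsub>H\<^esub> x = B" if "x \<in> carrier H" for x
      using that unfolding carrier_FactGroup by blast
    then show "carrier H \<subseteq> B"
      using group.coset_join1[OF H _ _ assms(2)] by blast
  next
    assume "carrier H \<subseteq> B"
    moreover have "\<one>\<^bsub>H\<^esub> \<in> carrier H"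
      using H by (simp add: group.is_monoid)
    ultimately show "carrier (H Mod B) = {B}"
      using group.coset_join2[OF H _ assms(2)] by (force simp: carrier_FactGroup)
  qed
  then show ?thesis
    using mod_subgroup_group[OF assms] by (simp add: trivial_group_def)
qed

definition cycle_group :: "nat \<Rightarrow> 'a::order set set \<Rightarrow> ('a set \<Rightarrow>\<^sub>0 int) monoid"
  where "cycle_group k K = subgroup_generated (free_Abelian_group {\<sigma> \<in> K. card \<sigma> = k}) (cycles k K)"

text \<open>An index shift from dimension to number of vertices. The target group of the boundary
  map enters the kernel only through its neutral element \<open>0\<close>.\<close>

lemma reduced_simplicial_homology_group_eq:
  "reduced_simplicial_homology_group (int k - 1) K =
    cycle_group k (insert {} K) Mod simplicial_boundary ` simplicial_chains (Suc k) (insert {} K)"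
proof -
  have chain: "simplicial_chain_group (int j - 1) K = free_Abelian_group {\<sigma> \<in> insert {} K. card \<sigma> = j}" for j
    unfolding simplicial_chain_group_def simplices_def by simp
  have "simplicial_cycles (int k - 1) K = cycles k (insert {} K)"
    unfolding simplicial_cycles_def kernel_def chain cycles_def simplicial_chains_def
    by (simp add: simplicial_chain_group_def)
  moreover have "simplicial_boundaries (int k - 1) K = simplicial_boundary ` simplicial_chains (Suc k) (insert {} K)"
    using chain[of "Suc k"] unfolding simplicial_boundaries_def simplicial_chains_def
    by (simp add: free_Abelian_group_def)
  ultimately show ?thesis
    by (simp add: reduced_simplicial_homology_group_def cycle_group_def chain)
qed

lemma subgroup_cycles: "subgroup (cycles k K) (free_Abelian_group {\<sigma> \<in> K. card \<sigma> = k})"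
proof
  show "cycles k K \<subseteq> carrier (free_Abelian_group {\<sigma> \<in> K. card \<sigma> = k})"
    by (auto simp: cycles_def simplicial_chains_def)
  then have "Poly_Mapping.keys x \<subseteq> {\<sigma> \<in> K. card \<sigma> = k}" if "x \<in> cycles k K" for x
    using that unfolding carrier_free_Abelian_group_iff[symmetric] by (rule subsetD)
  then show "inv\<^bsub>free_Abelian_group {\<sigma> \<in> K. card \<sigma> = k}\<^esub> x \<in> cycles k K" if "x \<in> cycles k K" for x
    using that cycles_minus[OF that] by simp
qed (auto simp: cycles_def boundary_add simplicial_chains_add)

lemma carrier_cycle_group [simp]: "carrier (cycle_group k K) = cycles k K"
  unfolding cycle_group_def by (rule subgroup.carrier_subgroup_generated_subgroup[OF subgroup_cycles])

lemma comm_group_cycle_group: "comm_group (cycle_group k K)"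
  unfolding cycle_group_def
  by (rule group.abelian_subgroup_generated[OF group_free_Abelian_group abelian_free_Abelian_group])

lemma subgroup_boundaries:
  assumes K: "ordered_complex K"
  shows "subgroup (simplicial_boundary ` simplicial_chains (Suc k) K) (cycle_group k K)"
proof -
  let ?B = "simplicial_boundary ` simplicial_chains (Suc k) K"
  let ?G = "free_Abelian_group {\<sigma> \<in> K. card \<sigma> = k}"
  have sub: "?B \<subseteq> cycles k K"
    using boundary_in_chains[OF K] boundary_boundary[OF K] by (auto simp: cycles_def)
  have "subgroup ?B ?G"
  proof
    show "?B \<subseteq> carrier ?G"
      using sub subgroup.subset[OF subgroup_cycles] by blast
    show "inv\<^bsub>?G\<^esub> x \<in> ?B" if x: "x \<in> ?B" for x
    proof -
      obtain c where c: "x = simplicial_boundary c" "c \<in> simplicial_chains (Suc k) K"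
        using x by blast
      have "x \<in> carrier ?G"
        using x \<open>?B \<subseteq> carrier ?G\<close> by (rule rev_subsetD)
      then have "inv\<^bsub>?G\<^esub> x = - x"
        by simp
      then show ?thesis
        using c imageI[OF simplicial_chains_minus[OF c(2)], of simplicial_boundary]
        by (simp add: boundary_minus)
    qed
    show "x \<otimes>\<^bsub>?G\<^esub> y \<in> ?B" if "x \<in> ?B" "y \<in> ?B" for x y
      using that by (auto simp flip: boundary_add intro!: imageI simp: simplicial_chains_add)
    show "\<one>\<^bsub>?G\<^esub> \<in> ?B"
      by (auto intro!: image_eqI[of _ _ 0])
  qed
  then show ?thesis
    unfolding cycle_group_def using sub by (intro group.subgroup_of_subgroup_generated) auto
qed

lemma trivial_homology_iff_exact:
  assumes "ordered_complex (insert {} K)"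
  shows "trivial_group (reduced_simplicial_homology_group (int k - 1) K) \<longleftrightarrow> exact_at k (insert {} K)"
  using trivial_group_mod_iff[OF comm_group_cycle_group subgroup_boundaries[OF assms]]
  by (simp add: reduced_simplicial_homology_group_eq exact_at_def)

lemma group_reduced_simplicial_homology_group:
  assumes "ordered_complex (insert {} K)"
  shows "group (reduced_simplicial_homology_group (int k - 1) K)"
  unfolding reduced_simplicial_homology_group_eq
  using comm_group_cycle_group subgroup_boundaries[OF assms] by (rule mod_subgroup_group)

text \<open>No simplex has more than \<open>k\<close> vertices, so the only boundary in this degree
  is zero and the homology group is the cycle group. Its integer powers are scalar multiples, so a
  generator as a cyclic group is the required chain.\<close>

lemma integer_homology_generator:
  assumes ord: "ordered_complex (insert {} K)"
    and dim: "\<And>\<sigma>. \<sigma> \<in> K \<Longrightarrow> card \<sigma> \<le> k"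
    and iso: "reduced_simplicial_homology_group (int k - 1) K \<cong> integer_group"
  shows "\<exists>g\<in>cycles k (insert {} K). g \<noteq> 0 \<and> cycles k (insert {} K) \<subseteq> range (\<lambda>n. frag_cmul n g)"
proof -
  let ?Z = "cycle_group k (insert {} K)"
  let ?G = "free_Abelian_group {\<sigma> \<in> insert {} K. card \<sigma> = k}"
  have Z: "group ?Z"
    using comm_group_cycle_group comm_group_def by blast
  have one: "\<one>\<^bsub>?Z\<^esub> = 0"
    by (simp add: cycle_group_def)
  have "card \<sigma> \<noteq> Suc k" if "\<sigma> \<in> insert {} K" for \<sigma>
    using dim[of \<sigma>] that by auto
  then have "{\<sigma> \<in> insert {} K. card \<sigma> = Suc k} = {}"
    by blast
  then have "simplicial_chains (Suc k) (insert {} K) = {0}"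
    unfolding simplicial_chains_def by (simp only: subset_empty keys_eq_empty) simp
  then have "reduced_simplicial_homology_group (int k - 1) K = ?Z Mod {\<one>\<^bsub>?Z\<^esub>}"
    by (simp add: reduced_simplicial_homology_group_eq one)
  then have Z_iso: "?Z \<cong> integer_group"
    using group.trivial_factor_iso[OF Z] iso group_reduced_simplicial_homology_group[OF ord, of k]
    by (metis group.iso_sym is_isoI iso_trans)
  have "cyclic_group ?Z" and nontrivial: "\<not> trivial_group ?Z"
    using isomorphic_group_cyclicity[OF Z_iso Z] isomorphic_group_triviality[OF Z_iso Z] by simp_all
  then obtain g where g: "g \<in> cycles k (insert {} K)" "cycles k (insert {} K) = range (\<lambda>n::int. g [^]\<^bsub>?Z\<^esub> n)"
    using group.cyclic_group[OF Z] by auto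
  have "Poly_Mapping.keys g \<subseteq> {\<sigma> \<in> insert {} K. card \<sigma> = k}"
    using g(1) by (simp add: cycles_def simplicial_chains_def)
  then have pow: "g [^]\<^bsub>?Z\<^esub> n = frag_cmul n g" for n :: int
    using group.int_pow_subgroup_generated[OF group_free_Abelian_group, of g _ "cycles k (insert {} K)" n]
      g(1) carrier_cycle_group[of k "insert {} K"]
    unfolding cycle_group_def by (metis int_pow_free_Abelian_group)
  have "g \<noteq> 0"
  proof
    assume "g = 0"
    then have "carrier ?Z = {\<one>\<^bsub>?Z\<^esub>}"
      using g(2) pow one by auto
    then show False
      using nontrivial Z by (simp add: trivial_group_def)
  qed
  moreover have "cycles k (insert {} K) \<subseteq> range (\<lambda>n. frag_cmul n g)"
    unfolding g(2) pow by (rule subset_refl)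
  ultimately show ?thesis
    using g(1) by blast
qed

text \<open>For \<open>m = 0\<close> the sphere is empty and its homology is prescribed directly;
  for \<open>m = Suc d\<close> it is the known reduced homology of \<open>nsphere d\<close>.\<close>

lemma has_homology_of_sphere_imp:
  assumes ord: "ordered_complex (insert {} K)"
    and dim: "\<And>\<sigma>. \<sigma> \<in> K \<Longrightarrow> card \<sigma> \<le> m"
    and sph: "has_homology_of_sphere (int m - 1) K"
  shows "sphere_homology m (insert {} K)"
proof -
  have *: "reduced_simplicial_homology_group (int m - 1) K \<cong> integer_group \<and>
      (\<forall>k. k \<noteq> m \<longrightarrow> trivial_group (reduced_simplicial_homology_group (int k - 1) K))"
  proof (cases m)
    case 0
    then show ?thesis
      using sph by (auto simp: has_homology_of_sphere_def)
  next
    case (Suc d)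
    have iso: "reduced_simplicial_homology_group p K \<cong> reduced_homology_group p (nsphere d)" for p
      using sph Suc by (simp add: has_homology_of_sphere_def)
    have "trivial_group (reduced_simplicial_homology_group (int k - 1) K)" if "k \<noteq> m" for k
      using isomorphic_group_triviality[OF iso group_reduced_simplicial_homology_group[OF ord]
          group_reduced_homology_group, of k] that Suc
      by (simp add: trivial_reduced_homology_group_nsphere)
    moreover have "reduced_simplicial_homology_group (int m - 1) K \<cong> integer_group"
      using iso_trans[OF iso reduced_homology_group_nsphere(1)[of d]] Suc by simp
    ultimately show ?thesis by blast
  qed
  then show ?thesis
    using integer_homology_generator[OF ord dim] trivial_homology_iff_exact[OF ord]
    by (simp add: sphere_homology_def)
qed

text \<open>The link of \<open>\<sigma>\<close> in the link of \<open>C\<close> is the link of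
  \<open>C \<union> \<sigma>\<close> in \<open>K\<close>. This union is a non-empty simplex, so the
  manifold condition applies to it.\<close>

lemma closed_homology_manifold_link:
  assumes man: "closed_homology_manifold n K" and ord: "ordered_complex (insert {} K)"
    and nonempty: "{} \<notin> K" and C: "C \<in> K"
  shows "homology_sphere_complex (nat (n + 1) - card C) (link (insert {} K) C)"
  unfolding homology_sphere_complex_def
proof (intro conjI ballI)
  have sph: "has_homology_of_sphere (n - int (card \<sigma>)) (link K \<sigma>)" if "\<sigma> \<in> K" for \<sigma>
  proof -
    have "\<sigma> \<in> simplices (int (card \<sigma>) - 1) K"
      using that by (simp add: simplices_def)
    then show ?thesis
      using man unfolding closed_homology_manifold_def by force
  qed
  \<comment> \<open>A sphere has dimension at least \<open>-1\<close>, which bounds the number of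
    vertices of every simplex.\<close>
  have card_le: "int (card \<sigma>) \<le> n + 1" if "\<sigma> \<in> K" for \<sigma>
    using sph[OF that] by (auto simp: has_homology_of_sphere_def split: if_splits)
  show "ordered_complex (link (insert {} K) C)"
    using ord C by (simp add: ordered_complex_link)
  fix \<sigma> assume \<sigma>: "\<sigma> \<in> link (insert {} K) C"
  define \<rho> where "\<rho> = C \<union> \<sigma>"
  have \<rho>: "\<rho> \<in> K"
    using \<sigma> C nonempty by (auto simp: link_def \<rho>_def Un_commute)
  have fin: "finite \<tau>" if "\<tau> \<in> K" for \<tau>
    using ordered_complex_finite[OF ord] that by simp
  have card: "card \<rho> = card C + card \<sigma>"
    using fin[OF \<rho>] \<sigma> unfolding \<rho>_def by (intro card_Un_disjoint) (auto simp: link_def)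
  have link: "link (insert {} K) \<rho> = insert {} (link K \<rho>)"
    using \<rho> nonempty by (auto simp: link_def)
  have dim: "card \<tau> \<le> nat (n + 1) - card \<rho>" if "\<tau> \<in> link K \<rho>" for \<tau>
  proof -
    have "\<tau> \<union> \<rho> \<in> K" "\<tau> \<inter> \<rho> = {}"
      using that by (auto simp: link_def)
    moreover have "card (\<tau> \<union> \<rho>) = card \<tau> + card \<rho>"
      using calculation fin by (intro card_Un_disjoint) (auto dest: fin)
    ultimately show ?thesis
      using card_le[of "\<tau> \<union> \<rho>"] by linarith
  qed
  show "card \<sigma> \<le> nat (n + 1) - card C"
    using card_le[OF \<rho>] card by linarith
  have "int (nat (n + 1) - card \<rho>) - 1 = n - int (card \<rho>)"
    using card_le[OF \<rho>] by linarith
  then have "sphere_homology (nat (n + 1) - card \<rho>) (link (insert {} K) \<rho>)"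
    using sph[OF \<rho>] dim ordered_complex_link[OF ord, of \<rho>] \<rho> unfolding link
    by (intro has_homology_of_sphere_imp) auto
  then show "sphere_homology (nat (n + 1) - card C - card \<sigma>) (link (link (insert {} K) C) \<sigma>)"
    using link_link[OF ord \<sigma>] card by (simp add: \<rho>_def)
qed

section \<open>Order complexes, their links and acyclicity\<close>

lemma ordered_complex_order_complex:
  assumes "finite X"
  shows "ordered_complex (insert {} (order_complex X))"
proof -
  have "\<Union>(insert {} (order_complex X)) \<subseteq> X"
    by (auto simp: order_complex_def)
  then have "finite (\<Union>(insert {} (order_complex X)))"
    using assms finite_subset by blast
  then show ?thesis
    by (simp add: ordered_complex_def order_complex_def Complete_Partial_Order.chain_def) (meson subset_trans subsetD)
qed

text \<open>Take \<open>C\<close> maximal among the chains with least element \<open>x\<close>. A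
  simplex of its link consists of elements comparable to \<open>x\<close>, and none can lie above
  \<open>x\<close> by maximality; conversely, a chain below \<open>x\<close> extends
  \<open>C\<close>.\<close>

lemma link_of_maximal_chain_above:
  fixes X :: "'a::order set"
  assumes "finite X" "x \<in> X"
  obtains C where "C \<in> order_complex X"
    "link (insert {} (order_complex X)) C = insert {} (order_complex (strict_below X x))"
proof -
  define S where "S = {C. C \<subseteq> X \<and> x \<in> C \<and> Complete_Partial_Order.chain (\<le>) C \<and> (\<forall>c\<in>C. x \<le> c)}"
  have "finite S"
    using assms(1) by (auto simp: S_def)
  moreover have "{x} \<in> S"
    using assms(2) by (auto simp: S_def Complete_Partial_Order.chain_def)
  ultimately obtain C where C: "C \<in> S" and max: "\<And>D. D \<in> S \<Longrightarrow> C \<subseteq> D \<Longrightarrow> D = C"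
    using finite_has_maximal[of S] by blast
  have comparable: "a \<le> b \<or> b \<le> a" if "Complete_Partial_Order.chain (\<le>) A" "a \<in> A" "b \<in> A" for a b :: 'a and A
    using that by (rule Complete_Partial_Order.chainD)
  have "C \<in> order_complex X"
    using C by (auto simp: S_def order_complex_def)
  moreover have "\<tau> \<in> insert {} (order_complex (strict_below X x))"
    if \<tau>: "\<tau> \<in> link (insert {} (order_complex X)) C" for \<tau>
  proof -
    have disj: "\<tau> \<inter> C = {}" and "\<tau> \<union> C \<noteq> {}"
      using \<tau> C by (auto simp: link_def S_def)
    then have sub: "\<tau> \<union> C \<subseteq> X" and chain: "Complete_Partial_Order.chain (\<le>) (\<tau> \<union> C)"
      using \<tau> by (auto simp: link_def order_complex_def)
    have "t < x" if t: "t \<in> \<tau>" for t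
    proof (rule ccontr)
      assume "\<not> t < x"
      moreover have "t \<le> x \<or> x \<le> t" "t \<noteq> x"
        using comparable[OF chain, of t x] t disj C by (auto simp: S_def)
      ultimately have "x \<le> t"
        by auto
      \<comment> \<open>An element above \<open>x\<close> and comparable to all of \<open>C\<close>
        would enlarge \<open>C\<close>.\<close>
      then have "insert t C \<in> S"
        using C t sub comparable[OF chain] by (auto simp: S_def intro!: Complete_Partial_Order.chainI)
      then have "insert t C = C"
        by (rule max) blast
      then show False
        using t disj by blast
    qed
    then show ?thesis
      using sub comparable[OF chain]
      by (auto simp: order_complex_def strict_below_def intro!: Complete_Partial_Order.chainI)
  qed
  moreover have "\<tau> \<in> link (insert {} (order_complex X)) C"
    if \<tau>: "\<tau> \<in> insert {} (order_complex (strict_below X x))" for \<tau>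
  proof -
    have chain: "Complete_Partial_Order.chain (\<le>) \<tau>" "Complete_Partial_Order.chain (\<le>) C"
      using \<tau> C by (auto simp: order_complex_def S_def Complete_Partial_Order.chain_def)
    have below: "t < c" if "t \<in> \<tau>" "c \<in> C" for t c
      using that \<tau> C by (auto simp: order_complex_def strict_below_def S_def intro: less_le_trans)
    have "Complete_Partial_Order.chain (\<le>) (\<tau> \<union> C)"
      using comparable[OF chain(1)] comparable[OF chain(2)] below
      by (intro Complete_Partial_Order.chainI) (auto intro: less_imp_le)
    then show ?thesis
      using \<tau> C below chain
      by (auto simp: link_def order_complex_def S_def strict_below_def)
  qed
  ultimately show thesis
    by (intro that[of C]) blast+
qed

text \<open>Dimensions \<open>p \<ge> -1\<close> correspond to \<open>k = p + 1\<close>. In lower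
  dimensions there are no simplices, so the homology group is trivial.\<close>

lemma acyclic_poset_if_exact:
  assumes "finite X" "\<And>k. exact_at k (insert {} (order_complex X))"
  shows "acyclic_poset X"
  unfolding acyclic_poset_def
proof
  fix p :: int
  show "trivial_group (reduced_simplicial_homology_group p (order_complex X))"
  proof (cases "p \<ge> -1")
    case True
    then have "p = int (nat (p + 1)) - 1" by simp
    then show ?thesis
      using trivial_homology_iff_exact[OF ordered_complex_order_complex] assms by metis
  next
    case False
    let ?K = "order_complex X"
    let ?H = "subgroup_generated (simplicial_chain_group p ?K) (simplicial_cycles p ?K)"
    have "simplices p (insert {} ?K) = {}"
      using False by (auto simp: simplices_def)
    then have G: "simplicial_chain_group p ?K = free_Abelian_group {}"
      by (simp add: simplicial_chain_group_def)
    have H: "comm_group ?H"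
      unfolding G
      by (rule group.abelian_subgroup_generated[OF group_free_Abelian_group abelian_free_Abelian_group])
    \<comment> \<open>For \<open>p = -2\<close> these chains are multiples of the empty simplex,
      whose boundary is zero; for smaller \<open>p\<close> they are zero.\<close>
    have "simplicial_boundary c = 0" if "c \<in> carrier (simplicial_chain_group (p + 1) ?K)" for c
    proof -
      have "c \<in> simplicial_chains 0 (insert {} ?K)"
        using that False by (auto simp: simplicial_chain_group_def simplices_def simplicial_chains_def)
      then show ?thesis
        using boundary_chain_0 ordered_complex_order_complex[OF assms(1)] by blast
    qed
    moreover have "0 \<in> carrier (simplicial_chain_group (p + 1) ?K)"
      by (simp add: simplicial_chain_group_def)
    ultimately have "simplicial_boundaries p ?K = {0}"
      unfolding simplicial_boundaries_def by force
    moreover have "carrier ?H \<subseteq> {0}"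
      using group.carrier_subgroup_generated_subset[of "free_Abelian_group {}"] unfolding G
      by (auto simp: subset_iff)
    moreover have "subgroup {0} ?H"
      using group.triv_subgroup[of ?H] H by (simp add: comm_group_def G)
    ultimately show ?thesis
      using trivial_group_mod_iff[OF H] by (simp add: reduced_simplicial_homology_group_def)
  qed
qed

theorem theorem4p6:
  fixes X :: "'a::order set"
  assumes "finite X"
    and "finite_closed_homology_manifold X"
  shows "homologically_admissible X"
  unfolding homologically_admissible_def homologically_admissible_edge_def
proof (clarify)
  fix w x assume "(w, x) \<in> hasse_edges X"
  then have x: "x \<in> X" and w: "w \<in> X" "w < x"
    by (auto simp: hasse_edges_def)
  let ?K = "insert {} (order_complex (strict_below X x))"
  obtain n where man: "closed_homology_manifold n (order_complex X)"
    using assms(2) by (auto simp: finite_closed_homology_manifold_def)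
  obtain C where C: "C \<in> order_complex X" "link (insert {} (order_complex X)) C = ?K"
    using link_of_maximal_chain_above[OF assms(1) x] by blast
  have "{} \<notin> order_complex X"
    by (simp add: order_complex_def)
  then have "homology_sphere_complex (nat (n + 1) - card C) ?K"
    using closed_homology_manifold_link[OF man ordered_complex_order_complex[OF assms(1)] _ C(1)] C(2)
    by simp
  moreover have "{w} \<in> ?K"
    using w by (auto simp: order_complex_def strict_below_def Complete_Partial_Order.chain_def)
  ultimately have "exact_at k (deletion ?K w)" for k
    by (rule deletion_exact)
  \<comment> \<open>Removing a point from a poset deletes the corresponding vertex from its order
    complex.\<close>
  moreover have "deletion ?K w = insert {} (order_complex (strict_below X x - {w}))"
    by (auto simp: deletion_def order_complex_def)
  ultimately show "acyclic_poset (strict_below X x - {w})"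
    using assms(1) by (intro acyclic_poset_if_exact) (auto simp: strict_below_def)
qed

end
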